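(* Let $X=\sum_{i=1}^nc_iX_i$ with $c_i\in\mathbb{R}$, let $k$ be a positive integer, and let $C_{\boldsymbol{\lambda}}$ be a conjugacy class of $\mathfrak{S}_{n,r}$. If $C_{\boldsymbol{\lambda}}$ contains no cycles of lengths $1,2,\ldots,2k$, then $\mathbb{E}_{C_{\boldsymbol{\lambda}}}[X^k]=\mathbb{E}_{\mathfrak{S}_{n,r}}[X^k]$. Furthermore, if $c_n=0$, then this is also equal to $\mathbb{E}_{\mathfrak{S}_n}[X^k]$, where on $\mathfrak{S}_n$ the statistic $X=\sum_{i=1}^{n-1}c_iX_i$ is formed from the classical descent indicators.
   Context: $\mathfrak{S}_{n,r}$ is the set of pairs $(\omega,\tau)$, $\omega\in\mathfrak{S}_n$, $\tau:[n]\to\mathbb{Z}_r$ (colors $0,\ldots,r-1$), with product $(\omega_1,\tau_1)(\omega_2,\tau_2)=(\omega_1\omega_2,\tau_1\circ\omega_2+\tau_2)$; $\mathfrak{S}_n$ is identified with $\mathfrak{S}_{n,1}$. Order symbols $i^c$ by $1^0<\cdots<n^0<1^1<\cdots<n^1<\cdots<1^{r-1}<\cdots<n^{r-1}$. An index $i\in[n]$ is a descent of $(\omega,\tau)$ if $\omega(i)^{\tau(i)}>\omega(i+1)^{\tau(i+1)}$, with convention $\omega(n+1)=n+1$, $\tau(n+1)=0$; $X_i$ is the indicator that $i$ is a descent. For a cycle $(i_1\cdots i_\ell)$ of $\omega$, its length is $\ell$ and color $\sum_h\tau(i_h)\in\mathbb{Z}_r$; the cycle type $\boldsymbol{\lambda}=(\lambda^0,\ldots,\lambda^{r-1})$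 has $\lambda^j$ listing lengths of cycles of color $j$; conjugacy classes are the sets $C_{\boldsymbol{\lambda}}$ of elements of a given cycle type; "no cycles of lengths $1,\ldots,m$" means no part of any $\lambda^j$ lies in $\{1,\ldots,m\}$. Expectations are with respect to uniform distributions. *)

theory Defs
  imports "HOL-Probability.Probability" "HOL-Combinatorics.Combinatorics"
begin

text \<open>Colours in \<open>\<int>/r\<int>\<close> are represented by their residues in \<open>{0..<r}\<close>. Colourings are extensional,
  so that distinct elements of this set are distinct coloured permutations of \<open>{1..n}\<close>.\<close>

definition colored_perms :: "nat \<Rightarrow> nat \<Rightarrow> ((nat \<Rightarrow> nat) \<times> (nat \<Rightarrow> nat)) set" where
  "colored_perms n r = {\<omega>. \<omega> permutes {1..n}} \<times> ({1..n} \<rightarrow>\<^sub>E {0..<r})"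

text \<open>A symbol \<open>i\<^sup>c\<close> is the pair \<open>(i, c)\<close>; colours are compared first.\<close>

definition symbol_less :: "nat \<times> nat \<Rightarrow> nat \<times> nat \<Rightarrow> bool" where
  "symbol_less a b \<longleftrightarrow> snd a < snd b \<or> snd a = snd b \<and> fst a < fst b"

definition symbol_at :: "nat \<Rightarrow> (nat \<Rightarrow> nat) \<times> (nat \<Rightarrow> nat) \<Rightarrow> nat \<Rightarrow> nat \<times> nat" where
  "symbol_at n g i = (if i = n + 1 then (n + 1, 0) else (fst g i, snd g i))"

definition descent :: "nat \<Rightarrow> (nat \<Rightarrow> nat) \<times> (nat \<Rightarrow> nat) \<Rightarrow> nat \<Rightarrow> bool" where
  "descent n g i \<longleftrightarrow> symbol_less (symbol_at n g (i + 1)) (symbol_at n g i)"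

definition weighted_descents ::
    "nat \<Rightarrow> (nat \<Rightarrow> real) \<Rightarrow> (nat \<Rightarrow> nat) \<times> (nat \<Rightarrow> nat) \<Rightarrow> real" where
  "weighted_descents n c g = (\<Sum>i = 1..n. c i * of_bool (descent n g i))"

definition classical_weighted_descents :: "nat \<Rightarrow> (nat \<Rightarrow> real) \<Rightarrow> (nat \<Rightarrow> nat) \<Rightarrow> real" where
  "classical_weighted_descents n c \<omega> = (\<Sum>i = 1..<n. c i * of_bool (\<omega> i > \<omega> (i + 1)))"

text \<open>A cycle, fixed points included, is represented by its support, an orbit of \<open>\<omega>\<close>.\<close>

definition cycle_supports :: "nat \<Rightarrow> (nat \<Rightarrow> nat) \<Rightarrow> nat set set" where
  "cycle_supports n \<omega> = orbit \<omega> ` {1..n}"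

definition cycle_color :: "nat \<Rightarrow> (nat \<Rightarrow> nat) \<Rightarrow> nat set \<Rightarrow> nat" where
  "cycle_color r \<tau> A = (\<Sum>h\<in>A. \<tau> h) mod r"

text \<open>Entry \<open>j < r\<close> of the list is the partition \<open>\<lambda>\<^sup>j\<close>, as the multiset of its parts.\<close>

definition colored_cycle_type ::
    "nat \<Rightarrow> nat \<Rightarrow> (nat \<Rightarrow> nat) \<times> (nat \<Rightarrow> nat) \<Rightarrow> nat multiset list" where
  "colored_cycle_type n r g =
     map (\<lambda>j. image_mset card (mset_set {A \<in> cycle_supports n (fst g). cycle_color r (snd g) A = j}))
       [0..<r]"

text \<open>The nonempty sets of this form are the conjugacy classes for the product
  \<open>(\<omega>\<^sub>1, \<tau>\<^sub>1) (\<omega>\<^sub>2, \<tau>\<^sub>2) = (\<omega>\<^sub>1 \<circ> \<omega>\<^sub>2, \<tau>\<^sub>1 \<circ> \<omega>\<^sub>2 + \<tau>\<^sub>2)\<close>.\<close>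

definition colored_class :: "nat \<Rightarrow> nat \<Rightarrow> nat multiset list \<Rightarrow> ((nat \<Rightarrow> nat) \<times> (nat \<Rightarrow> nat)) set" where
  "colored_class n r \<Lambda> = {g \<in> colored_perms n r. colored_cycle_type n r g = \<Lambda>}"

definition uniform_expectation :: "'a set \<Rightarrow> ('a \<Rightarrow> real) \<Rightarrow> real" where
  "uniform_expectation A f = measure_pmf.expectation (pmf_of_set A) f"

end

theory Submission
  imports Defs
begin

text \<open>
  Expanding \<open>X\<^sup>k\<close> reduces the claim to the probabilities \<open>P(S \<subseteq> Des)\<close> with \<open>|S| \<le> k\<close>. The positions
  involved, \<open>S \<union> (S + 1)\<close>, number at most \<open>2k\<close> and split into maximal runs of consecutive indices, each
  of which has to be sorted decreasingly; in the run that reaches the boundary symbol \<open>(n + 1)\<^sup>0\<close> all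
  colours must moreover be nonzero.

  Let the permutations \<open>\<sigma>\<close> preserving each run act by conjugation. Exactly one \<open>\<sigma>\<close> sorts a given \<open>g\<close>:
  two images lying in different runs (or outside) compare independently of \<open>\<sigma>\<close>, and two images in the
  same run compare as their own images do. This recursion stops because no cycle is short enough to
  stay inside \<open>S \<union> (S + 1)\<close>. For the same reason conjugation by colourings makes the colours on the last
  run uniform. On the full group, right multiplication in place of conjugation gives the same count.
\<close>

subsection \<open>Permutations preserving runs\<close>

text \<open>An element \<open>i\<close> of \<open>T\<close> joins the positions \<open>i\<close> and
  \<open>i + 1\<close>, so the classes of \<open>linked T\<close> are the runs. The interval is
  half-open because a run has one position more than it has joining elements.\<close>

definition linked :: "nat set \<Rightarrow> nat \<Rightarrow> nat \<Rightarrow> bool" where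
  "linked T x y \<longleftrightarrow> {min x y..<max x y} \<subseteq> T"

text \<open>For \<open>T \<subseteq> {1..<n}\<close> this is the Young subgroup of the partition of
  \<open>{1..n}\<close> into runs.\<close>

definition block_perms :: "nat \<Rightarrow> nat set \<Rightarrow> (nat \<Rightarrow> nat) set" where
  "block_perms n T = {\<sigma>. \<sigma> permutes {1..n} \<and> (\<forall>x. linked T (\<sigma> x) x)}"

lemma linked_refl [simp]: "linked T x x"
  by (simp add: linked_def)

lemma linked_sym: "linked T x y \<longleftrightarrow> linked T y x"
  by (simp add: linked_def min.commute max.commute)

lemma linked_trans:
  assumes "linked T x y" "linked T y z"
  shows "linked T x z"
proof -
  have "{min x z..<max x z} \<subseteq> {min x y..<max x y} \<union> {min y z..<max y z}"
    by auto
  then show ?thesis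
    using assms unfolding linked_def by blast
qed

lemma linked_less: "x < y \<Longrightarrow> linked T x y \<longleftrightarrow> {x..<y} \<subseteq> T"
  by (simp add: linked_def)

lemma linked_between:
  assumes "linked T x y" "x \<le> u" "u \<le> y"
  shows "linked T x u"
  using assms unfolding linked_def by (auto simp: subset_iff min_def max_def split: if_splits)

text \<open>Contrapositively, a position outside \<open>T\<close> and its shift by one is alone in
  its run; this is where the recursion along a permutation stops.\<close>

lemma linked_distinct_mem:
  assumes "linked T x y" "x \<noteq> y"
  shows "x \<in> T \<union> Suc ` T"
proof (cases "x < y")
  case True
  then show ?thesis using assms by (auto simp: linked_less)
next
  case False
  then have "y < x" using assms by simp
  then have "x - 1 \<in> T" "x = Suc (x - 1)"
    using assms by (auto simp: linked_sym[of T x] linked_less subset_iff)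
  then show ?thesis by blast
qed

lemma linked_distinct_range:
  assumes "T \<subseteq> {1..<n}" "linked T x y" "x \<noteq> y"
  shows "x \<in> {1..n}"
  using linked_distinct_mem[OF assms(2,3)] assms(1) by auto

lemma block_permsD:
  assumes "\<sigma> \<in> block_perms n T"
  shows "\<sigma> permutes {1..n}" "linked T (\<sigma> x) x" "linked T (\<sigma> x) (\<sigma> y) \<longleftrightarrow> linked T x y"
proof -
  show "\<sigma> permutes {1..n}" and *: "linked T (\<sigma> x) x" for x
    using assms by (simp_all add: block_perms_def)
  show "linked T (\<sigma> x) (\<sigma> y) \<longleftrightarrow> linked T x y"
    using *[of x] *[of y] linked_trans linked_sym by blast
qed

text \<open>Runs are intervals and every point stays in its run, so points of different runs cannot
  change order.\<close>

lemma block_perms_less_iff: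
  assumes \<sigma>: "\<sigma> \<in> block_perms n T" and "\<not> linked T x y"
  shows "\<sigma> x < \<sigma> y \<longleftrightarrow> x < y"
proof -
  have *: "\<sigma> u < \<sigma> v" if "u < v" "\<not> linked T u v" for u v
  proof (rule ccontr)
    assume "\<not> \<sigma> u < \<sigma> v"
    \<comment> \<open>If the images crossed, the stretches travelled by \<open>u\<close> and
      \<open>v\<close> would jointly cover the gap between them, which would then lie in
      \<open>T\<close>.\<close>
    then have "{u..<v} \<subseteq> {min (\<sigma> u) u..<max (\<sigma> u) u} \<union> {min (\<sigma> v) v..<max (\<sigma> v) v}"
      by auto
    also have "\<dots> \<subseteq> T"
      using block_permsD(2)[OF \<sigma>, of u] block_permsD(2)[OF \<sigma>, of v] by (simp add: linked_def)
    finally show False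
      using that by (simp add: linked_less)
  qed
  have "x \<noteq> y"
    using assms(2) by auto
  then show ?thesis
    using *[of x y] *[of y x] assms(2) linked_sym[of T x y] by (metis nat_neq_iff not_less_iff_gr_or_eq)
qed

lemma finite_block_perms [simp]: "finite (block_perms n T)"
proof (rule finite_subset)
  show "finite {\<sigma>. \<sigma> permutes {1..n}}" by (simp add: finite_permutations)
qed (auto simp: block_perms_def)

lemma block_perms_id: "id \<in> block_perms n T"
  by (simp add: block_perms_def permutes_id)

text \<open>Comparisons of values determine a permutation through ranks, and those across runs are
  forced by \<open>block_perms_less_iff\<close>, so those within runs suffice.\<close>

lemma block_perms_eqI:
  assumes T: "T \<subseteq> {1..<n}" and \<sigma>: "\<sigma> \<in> block_perms n T" and \<sigma>': "\<sigma>' \<in> block_perms n T"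
    and same: "\<And>x y. linked T x y \<Longrightarrow> \<sigma> x < \<sigma> y \<longleftrightarrow> \<sigma>' x < \<sigma>' y"
  shows "\<sigma> = \<sigma>'"
proof
  have rank: "p x = Suc (card {y \<in> {1..n}. p y < p x})"
    if p: "p permutes {1..n}" and x: "x \<in> {1..n}" for p x
  proof -
    have px: "p x \<in> {1..n}"
      using permutes_in_image[OF p] x by blast
    have "p ` {y \<in> {1..n}. p y < p x} = {1..<p x}"
    proof
      show "{1..<p x} \<subseteq> p ` {y \<in> {1..n}. p y < p x}"
      proof
        fix v assume v: "v \<in> {1..<p x}"
        then have "v \<in> p ` {1..n}"
          using px by (simp only: permutes_image[OF p]) auto
        then show "v \<in> p ` {y \<in> {1..n}. p y < p x}"
          using v by auto
      qed
      show "p ` {y \<in> {1..n}. p y < p x} \<subseteq> {1..<p x}"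
        using permutes_image[OF p] by fastforce
    qed
    moreover have "card (p ` {y \<in> {1..n}. p y < p x}) = card {y \<in> {1..n}. p y < p x}"
      by (rule card_image) (rule permutes_inj_on[OF p])
    ultimately have "p x - 1 = card {y \<in> {1..n}. p y < p x}"
      by simp
    moreover have "1 \<le> p x" using px by simp
    ultimately show ?thesis by linarith
  qed
  fix x
  have all: "\<sigma> u < \<sigma> v \<longleftrightarrow> \<sigma>' u < \<sigma>' v" for u v
    using same block_perms_less_iff[OF \<sigma>] block_perms_less_iff[OF \<sigma>'] by (cases "linked T u v") auto
  show "\<sigma> x = \<sigma>' x"
  proof (cases "x \<in> {1..n}")
    case True
    then show ?thesis
      using rank[OF block_permsD(1)[OF \<sigma>] True] rank[OF block_permsD(1)[OF \<sigma>'] True]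
      by (simp only: all)
  next
    case False
    then show ?thesis
      using permutes_not_in[OF block_permsD(1)[OF \<sigma>]] permutes_not_in[OF block_permsD(1)[OF \<sigma>']] by simp
  qed
qed

text \<open>Sorting by counting: each point goes to the start of its run plus the number of run
  members that precede it under the strict total order \<open>R\<close>.\<close>

lemma block_sort_exists:
  assumes T: "T \<subseteq> {1..<n}"
    and total: "\<And>x y. x \<noteq> y \<Longrightarrow> R x y \<or> R y x"
    and asym: "\<And>x y. R x y \<Longrightarrow> \<not> R y x"
    and trans: "\<And>x y z. R x y \<Longrightarrow> R y z \<Longrightarrow> R x z"
  shows "\<exists>\<sigma>\<in>block_perms n T. \<forall>x y. linked T x y \<longrightarrow> (\<sigma> x < \<sigma> y \<longleftrightarrow> R x y)"
proof -
  define B where "B x = {y \<in> {1..n}. linked T x y}" for x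
  define before where "before x = {y \<in> B x. R y x}" for x
  define \<sigma> where "\<sigma> x = (if x \<in> {1..n} then Min (B x) + card (before x) else x)" for x
  have fin: "finite (B x)" "finite (before x)" for x
    by (simp_all add: B_def before_def)
  have B_eq: "B x = B y" if "linked T x y" for x y
    using that linked_trans linked_sym unfolding B_def by blast
  have self: "x \<in> B x" if "x \<in> {1..n}" for x
    using that by (simp add: B_def)
  have linked_\<sigma>: "linked T (\<sigma> x) x \<and> \<sigma> x \<in> {1..n}" if x: "x \<in> {1..n}" for x
  proof -
    have ne: "B x \<noteq> {}" using self[OF x] by auto
    \<comment> \<open>\<open>x\<close> does not precede itself, so the offset is at most the length
      of the run minus one and \<open>\<sigma> x\<close> does not pass its end.\<close>
    have "card (before x) < card (B x)"
      by (rule psubset_card_mono[OF fin(1)]) (use self[OF x] asym in \<open>auto simp: before_def\<close>)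
    also have "\<dots> \<le> card {Min (B x)..Max (B x)}"
      by (rule card_mono) (use fin in auto)
    finally have le: "\<sigma> x \<le> Max (B x)" "Min (B x) \<le> \<sigma> x"
      using x by (auto simp: \<sigma>_def)
    have mem: "Min (B x) \<in> B x" "Max (B x) \<in> B x"
      using ne fin by simp_all
    then have "linked T (Min (B x)) (Max (B x))"
      unfolding B_def using linked_trans linked_sym by blast
    then have "linked T (Min (B x)) (\<sigma> x)"
      using le by (blast intro: linked_between)
    then have "linked T (\<sigma> x) x"
      using mem unfolding B_def using linked_trans linked_sym by blast
    moreover have "\<sigma> x \<in> {1..n}"
      using mem le unfolding B_def by auto
    ultimately show ?thesis by simp
  qed
  have mono: "\<sigma> x < \<sigma> y" if "linked T x y" "R x y" for x y
  proof -
    have "x \<noteq> y" using asym that(2) by blast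
    then have xy: "x \<in> {1..n}" "y \<in> {1..n}"
      using linked_distinct_range[OF T] that(1) linked_sym by blast+
    have "before x \<subset> before y"
      using B_eq[OF that(1)] self[OF xy(1)] that(2) trans asym unfolding before_def by blast
    then have "card (before x) < card (before y)"
      by (rule psubset_card_mono[OF fin(2)])
    then show ?thesis
      using xy B_eq[OF that(1)] by (simp add: \<sigma>_def)
  qed
  have "inj_on \<sigma> {1..n}"
  proof (rule inj_onI, rule ccontr)
    fix x y assume xy: "x \<in> {1..n}" "y \<in> {1..n}" "\<sigma> x = \<sigma> y" "x \<noteq> y"
    then have "linked T x y"
      using linked_\<sigma> linked_sym linked_trans by metis
    then show False
      using mono[of x y] mono[of y x] total[OF xy(4)] xy(3) linked_sym by auto
  qed
  then have "bij_betw \<sigma> {1..n} {1..n}"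
    using linked_\<sigma> by (simp add: bij_betw_def endo_inj_surj image_subset_iff)
  then have "\<sigma> permutes {1..n}"
    by (rule bij_imp_permutes) (auto simp: \<sigma>_def)
  moreover have "linked T (\<sigma> x) x" for x
    using linked_\<sigma>[of x] by (cases "x \<in> {1..n}") (auto simp: \<sigma>_def)
  ultimately have "\<sigma> \<in> block_perms n T"
    by (simp add: block_perms_def)
  moreover have "\<sigma> x < \<sigma> y \<longleftrightarrow> R x y" if "linked T x y" for x y
    using mono[OF that] mono[of y x] that linked_sym total asym by (metis less_asym less_irrefl)
  ultimately show ?thesis by blast
qed

section \<open>Decreasing rearrangement within runs\<close>

text \<open>\<open>\<sigma> x\<close> is the new position of the entry at \<open>x\<close>, so the
  comparison is reversed: larger symbols go further left. The word \<open>w\<close> is a parameter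
  because under conjugation it depends on \<open>\<sigma>\<close> itself.\<close>

definition sorts :: "nat set \<Rightarrow> (nat \<Rightarrow> nat) \<Rightarrow> (nat \<Rightarrow> nat) \<Rightarrow> (nat \<Rightarrow> nat) \<Rightarrow> bool" where
  "sorts T w \<tau> \<sigma> \<longleftrightarrow>
     (\<forall>x y. linked T x y \<longrightarrow> (\<sigma> x < \<sigma> y \<longleftrightarrow> symbol_less (w y, \<tau> y) (w x, \<tau> x)))"

text \<open>The case of keys fixed beforehand; injectivity of \<open>w\<close> makes the symbol
  order total even among equal colours. It serves right multiplication directly and drives the
  iteration for conjugation.\<close>

lemma ex1_block_sort:
  assumes T: "T \<subseteq> {1..<n}" and "inj w"
  shows "\<exists>!\<sigma>. \<sigma> \<in> block_perms n T \<and> sorts T w \<tau> \<sigma>"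
proof -
  have "\<exists>\<sigma>\<in>block_perms n T. sorts T w \<tau> \<sigma>"
    unfolding sorts_def
  proof (rule block_sort_exists[OF T])
    fix x y :: nat assume "x \<noteq> y"
    then have "w x \<noteq> w y" using assms(2) by (simp add: inj_eq)
    then show "symbol_less (w y, \<tau> y) (w x, \<tau> x) \<or> symbol_less (w x, \<tau> x) (w y, \<tau> y)"
      unfolding symbol_less_def by auto
  qed (auto simp: symbol_less_def)
  moreover have "\<sigma> = \<sigma>'"
    if "\<sigma> \<in> block_perms n T \<and> sorts T w \<tau> \<sigma>" "\<sigma>' \<in> block_perms n T \<and> sorts T w \<tau> \<sigma>'" for \<sigma> \<sigma>'
    using that by (intro block_perms_eqI[OF T]) (auto simp: sorts_def)
  ultimately show ?thesis by blast
qed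

text \<open>
  The desired \<open>\<sigma>\<close> are the fixed points of the map \<open>\<Phi>\<close> that sends \<open>\<sigma>\<close> to the permutation sorting the keys
  \<open>(\<sigma> (\<omega> x), \<tau> x)\<close>. After \<open>t\<close> iterations the order of \<open>x\<close> within its run no longer depends on the starting
  point once \<open>\<omega>\<close> leads out of the runs from \<open>x\<close> in at most \<open>t\<close> steps, so some iterate of \<open>\<Phi>\<close> is constant.
\<close>

lemma ex1_conj_sort:
  assumes T: "T \<subseteq> {1..<n}" and \<omega>: "\<omega> permutes {1..n}"
    and escape: "\<And>x. \<exists>i. (\<omega> ^^ i) x \<notin> T \<union> Suc ` T"
  shows "\<exists>!\<sigma>. \<sigma> \<in> block_perms n T \<and> sorts T (\<sigma> \<circ> \<omega>) \<tau> \<sigma>"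
proof -
  let ?B = "block_perms n T"
  have inj: "inj (\<sigma> \<circ> \<omega>)" if "\<sigma> \<in> ?B" for \<sigma>
    using permutes_inj[OF block_permsD(1)[OF that]] permutes_inj[OF \<omega>] by (rule inj_compose)
  then have ex: "\<forall>\<sigma>\<in>?B. \<exists>\<sigma>'. \<sigma>' \<in> ?B \<and> sorts T (\<sigma> \<circ> \<omega>) \<tau> \<sigma>'"
    using ex1_block_sort[OF T] by blast
  obtain \<Phi> where \<Phi>: "\<Phi> \<sigma> \<in> ?B" "sorts T (\<sigma> \<circ> \<omega>) \<tau> (\<Phi> \<sigma>)" if "\<sigma> \<in> ?B" for \<sigma>
    using bchoice[OF ex] by blast
  have \<Phi>_iff: "sorts T (\<sigma> \<circ> \<omega>) \<tau> \<sigma>' \<longleftrightarrow> \<sigma>' = \<Phi> \<sigma>" if "\<sigma> \<in> ?B" "\<sigma>' \<in> ?B" for \<sigma> \<sigma>'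
    using ex1_block_sort[OF T inj[OF that(1)], of \<tau>] \<Phi>[OF that(1)] that(2) by blast
  have iter: "(\<Phi> ^^ t) \<sigma> \<in> ?B" if "\<sigma> \<in> ?B" for t \<sigma>
    using that by (induction t) (auto intro: \<Phi>(1))
  have agree: "(\<Phi> ^^ t) \<sigma> x < (\<Phi> ^^ t) \<sigma> y \<longleftrightarrow> (\<Phi> ^^ t) \<sigma>' x < (\<Phi> ^^ t) \<sigma>' y"
    if "\<sigma> \<in> ?B" "\<sigma>' \<in> ?B" "linked T x y" "i \<le> t" "(\<omega> ^^ i) x \<notin> T \<union> Suc ` T" for t i x y \<sigma> \<sigma>'
    using that(3-5)
  proof (induction t arbitrary: i x y)
    case 0
    then have "x = y" using linked_distinct_mem by auto
    then show ?case by simp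
  next
    case (Suc t)
    show ?case
    proof (cases "x = y")
      case False
      let ?p = "(\<Phi> ^^ t) \<sigma>" and ?q = "(\<Phi> ^^ t) \<sigma>'"
      have p: "?p \<in> ?B" "?q \<in> ?B"
        using iter that by auto
      \<comment> \<open>Sharing a run with \<open>y\<close>, the point \<open>x\<close> has not
        escaped yet, so \<open>i\<close> is positive and \<open>\<omega> x\<close> escapes one step
        sooner.\<close>
      obtain j where i: "i = Suc j"
        using linked_distinct_mem[OF Suc.prems(1) False] Suc.prems(3) by (cases i) auto
      then have j: "j \<le> t" "(\<omega> ^^ j) (\<omega> x) \<notin> T \<union> Suc ` T"
        using Suc.prems(2,3) by (simp_all add: funpow_swap1)
      \<comment> \<open>Images in different runs are ordered alike by all block permutations; in a
        common run the induction hypothesis applies to the images.\<close>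
      have "?p (\<omega> x) < ?p (\<omega> y) \<longleftrightarrow> ?q (\<omega> x) < ?q (\<omega> y)"
      proof (cases "linked T (\<omega> x) (\<omega> y)")
        case True
        then show ?thesis using Suc.IH j by blast
      next
        case False
        then show ?thesis using block_perms_less_iff p by metis
      qed
      moreover have "\<omega> x \<noteq> \<omega> y"
        using False permutes_inj[OF \<omega>] by (simp add: inj_eq)
      moreover from this have "?p (\<omega> x) \<noteq> ?p (\<omega> y)" "?q (\<omega> x) \<noteq> ?q (\<omega> y)"
        using permutes_inj[OF block_permsD(1)[OF p(1)]] permutes_inj[OF block_permsD(1)[OF p(2)]]
        by (simp_all add: inj_eq)
      ultimately have "?p (\<omega> y) < ?p (\<omega> x) \<longleftrightarrow> ?q (\<omega> y) < ?q (\<omega> x)"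
        by linarith
      then have "symbol_less ((?p \<circ> \<omega>) y, \<tau> y) ((?p \<circ> \<omega>) x, \<tau> x) \<longleftrightarrow>
          symbol_less ((?q \<circ> \<omega>) y, \<tau> y) ((?q \<circ> \<omega>) x, \<tau> x)"
        by (simp add: symbol_less_def)
      then show ?thesis
        using \<Phi>(2)[OF p(1)] \<Phi>(2)[OF p(2)] Suc.prems(1) by (simp add: sorts_def)
    qed simp
  qed
  obtain e where e: "(\<omega> ^^ e x) x \<notin> T \<union> Suc ` T" for x
    using escape by metis
  \<comment> \<open>Only points of \<open>{1..n}\<close> can be linked to another point, so a finite
    maximum of escape times suffices.\<close>
  define N where "N = Max (e ` {1..n})"
  have const: "(\<Phi> ^^ N) \<sigma> = (\<Phi> ^^ N) \<sigma>'" if "\<sigma> \<in> ?B" "\<sigma>' \<in> ?B" for \<sigma> \<sigma>'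
  proof (rule block_perms_eqI[OF T iter[OF that(1)] iter[OF that(2)]])
    fix x y assume xy: "linked T x y"
    show "(\<Phi> ^^ N) \<sigma> x < (\<Phi> ^^ N) \<sigma> y \<longleftrightarrow> (\<Phi> ^^ N) \<sigma>' x < (\<Phi> ^^ N) \<sigma>' y"
    proof (cases "x = y")
      case False
      then have "e x \<le> N"
        using linked_distinct_range[OF T xy] by (simp add: N_def)
      then show ?thesis using agree[OF that xy _ e] by blast
    qed simp
  qed
  show ?thesis
  proof (rule ex1I)
    let ?\<sigma> = "(\<Phi> ^^ N) id"
    \<comment> \<open>Starting the iteration at \<open>\<Phi> id\<close> instead of
      \<open>id\<close> gives the same constant value.\<close>
    have "\<Phi> ?\<sigma> = ?\<sigma>"
      using const[OF \<Phi>(1) block_perms_id, OF block_perms_id] by (simp add: funpow_swap1)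
    then show "?\<sigma> \<in> ?B \<and> sorts T (?\<sigma> \<circ> \<omega>) \<tau> ?\<sigma>"
      using \<Phi>_iff iter[OF block_perms_id] by metis
  next
    fix \<sigma> assume \<sigma>: "\<sigma> \<in> ?B \<and> sorts T (\<sigma> \<circ> \<omega>) \<tau> \<sigma>"
    then have "\<Phi> \<sigma> = \<sigma>" using \<Phi>_iff by metis
    then have "(\<Phi> ^^ N) \<sigma> = \<sigma>" by (induction N) auto
    then show "\<sigma> = (\<Phi> ^^ N) id" using const \<sigma> block_perms_id by metis
  qed
qed

subsection \<open>Descent sets and counting\<close>

definition ordered :: "nat set \<Rightarrow> (nat \<Rightarrow> nat) \<times> (nat \<Rightarrow> nat) \<Rightarrow> bool" where
  "ordered T g \<longleftrightarrow>
     (\<forall>i\<in>T. symbol_less (fst g (Suc i), snd g (Suc i)) (fst g i, snd g i))"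

text \<open>The longest final segment of \<open>{1..n}\<close> inside \<open>S\<close>, where the
  boundary symbol has an effect; empty when \<open>n\<close> is not in \<open>S\<close>.\<close>

definition top_run :: "nat \<Rightarrow> nat set \<Rightarrow> nat set" where
  "top_run n S = {i \<in> {1..n}. {i..n} \<subseteq> S}"

definition nonzero_on :: "nat set \<Rightarrow> (nat \<Rightarrow> nat) \<times> (nat \<Rightarrow> nat) \<Rightarrow> bool" where
  "nonzero_on L g \<longleftrightarrow> (\<forall>x\<in>L. snd g x \<noteq> 0)"

text \<open>Adjacent descents along a run chain together by transitivity into all comparisons within
  it; conversely, each \<open>i\<close> in \<open>T\<close> is linked to
  \<open>Suc i\<close>.\<close>

lemma ordered_iff_sorts:
  assumes \<sigma>: "\<sigma> \<in> block_perms n T"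
  shows "ordered T (w \<circ> inv \<sigma>, \<tau> \<circ> inv \<sigma>) \<longleftrightarrow> sorts T w \<tau> \<sigma>"
proof
  let ?s = "\<lambda>i. (w (inv \<sigma> i), \<tau> (inv \<sigma> i))"
  note inv = permutes_inverses[OF block_permsD(1)[OF \<sigma>]]
  assume ord: "ordered T (w \<circ> inv \<sigma>, \<tau> \<circ> inv \<sigma>)"
  have less: "symbol_less (?s (Suc v)) (?s u)" if "u \<le> v" "{u..v} \<subseteq> T" for u v
    using that
  proof (induction v rule: dec_induct)
    case base
    then show ?case using ord by (auto simp: ordered_def)
  next
    case (step v)
    then have "{u..v} \<subseteq> T" "Suc v \<in> T" by auto
    then show ?case
      using step.IH ord unfolding ordered_def symbol_less_def by force
  qed
  have *: "symbol_less (w y, \<tau> y) (w x, \<tau> x)" if "linked T x y" "\<sigma> x < \<sigma> y" for x y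
  proof -
    obtain v where v: "\<sigma> y = Suc v" "\<sigma> x \<le> v"
      using \<open>\<sigma> x < \<sigma> y\<close> less_eq_Suc_le Suc_le_D by (metis Suc_le_mono)
    have "{\<sigma> x..v} \<subseteq> T"
      using that block_permsD(3)[OF \<sigma>, of x y] v by (auto simp: linked_less)
    then show ?thesis
      using less[OF v(2)] v(1) inv by metis
  qed
  show "sorts T w \<tau> \<sigma>"
    unfolding sorts_def
  proof (intro allI impI iffI)
    fix x y assume xy: "linked T x y" "symbol_less (w y, \<tau> y) (w x, \<tau> x)"
    then have "\<sigma> x \<noteq> \<sigma> y"
      using permutes_inj[OF block_permsD(1)[OF \<sigma>]] by (auto simp: inj_eq symbol_less_def)
    moreover have "\<not> \<sigma> y < \<sigma> x"
      using *[of y x] xy linked_sym by (auto simp: symbol_less_def)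
    ultimately show "\<sigma> x < \<sigma> y" by simp
  qed (use * in blast)
next
  note inv = permutes_inverses[OF block_permsD(1)[OF \<sigma>]]
  assume srt: "sorts T w \<tau> \<sigma>"
  show "ordered T (w \<circ> inv \<sigma>, \<tau> \<circ> inv \<sigma>)"
    unfolding ordered_def
  proof
    fix i assume "i \<in> T"
    then have "linked T i (Suc i)" by (simp add: linked_less)
    then have "linked T (inv \<sigma> i) (inv \<sigma> (Suc i))"
      using block_permsD(3)[OF \<sigma>, of "inv \<sigma> i" "inv \<sigma> (Suc i)"] inv by simp
    then show "symbol_less (fst (w \<circ> inv \<sigma>, \<tau> \<circ> inv \<sigma>) (Suc i), snd (w \<circ> inv \<sigma>, \<tau> \<circ> inv \<sigma>) (Suc i))
        (fst (w \<circ> inv \<sigma>, \<tau> \<circ> inv \<sigma>) i, snd (w \<circ> inv \<sigma>, \<tau> \<circ> inv \<sigma>) i)"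
      using srt inv unfolding sorts_def by (metis comp_apply fst_conv snd_conv lessI)
  qed
qed

lemma colored_permsD:
  assumes "g \<in> colored_perms n r"
  shows "fst g permutes {1..n}" "x \<in> {1..n} \<Longrightarrow> snd g x < r" "x \<notin> {1..n} \<Longrightarrow> snd g x = undefined"
  using assms unfolding colored_perms_def by (auto dest: PiE_arb PiE_mem)

text \<open>A descent at \<open>n\<close> against the boundary symbol means a nonzero colour there,
  since \<open>fst g n \<le> n\<close>. Colours weakly decrease along a sorted run, so this spreads
  left over the top run and becomes a condition that block permutations preserve.\<close>

lemma descents_iff:
  assumes g: "g \<in> colored_perms n r" and S: "S \<subseteq> {1..n}"
  shows "(\<forall>i\<in>S. descent n g i) \<longleftrightarrow> ordered (S - {n}) g \<and> nonzero_on (top_run n S) g"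
proof -
  have inner: "descent n g i \<longleftrightarrow> symbol_less (fst g (Suc i), snd g (Suc i)) (fst g i, snd g i)"
    if "i \<in> S - {n}" for i
    using that S by (auto simp: descent_def symbol_at_def)
  have last: "descent n g n \<longleftrightarrow> snd g n \<noteq> 0" if "n \<in> S"
  proof -
    have "n \<in> {1..n}" using that S by blast
    then have "fst g n \<in> {1..n}"
      using permutes_in_image[OF colored_permsD(1)[OF g]] by blast
    then show ?thesis
      by (auto simp: descent_def symbol_at_def symbol_less_def)
  qed
  have nonzero: "snd g i \<noteq> 0" if "snd g n \<noteq> 0" "ordered (S - {n}) g" "i \<le> n" "{i..n} \<subseteq> S" for i
    using that(3,4)
  proof (induction i rule: inc_induct)
    case base
    then show ?case using that(1) by simp
  next
    case (step i)
    then have "{Suc i..n} \<subseteq> S" "i \<in> S - {n}" by (auto simp: subset_iff)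
    with step.IH have "snd g (Suc i) \<noteq> 0" by simp
    moreover have "snd g (Suc i) \<le> snd g i"
      using that(2) \<open>i \<in> S - {n}\<close> unfolding ordered_def symbol_less_def
      by (metis fst_conv snd_conv less_imp_le order_refl)
    ultimately show ?case by linarith
  qed
  have mem: "n \<in> top_run n S" if "n \<in> S"
    using that S by (auto simp: top_run_def)
  have "(\<forall>i\<in>S. descent n g i) \<longleftrightarrow> ordered (S - {n}) g \<and> (n \<in> S \<longrightarrow> snd g n \<noteq> 0)"
  proof -
    have "(\<forall>i\<in>S. descent n g i) \<longleftrightarrow>
        (\<forall>i\<in>S - {n}. descent n g i) \<and> (n \<in> S \<longrightarrow> descent n g n)"
      by auto
    also have "(\<forall>i\<in>S - {n}. descent n g i) \<longleftrightarrow> ordered (S - {n}) g"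
      unfolding ordered_def by (rule ball_cong) (use inner in auto)
    finally show ?thesis using last by auto
  qed
  also have "\<dots> \<longleftrightarrow> ordered (S - {n}) g \<and> nonzero_on (top_run n S) g"
  proof (cases "n \<in> S")
    case True
    then show ?thesis
      using nonzero mem unfolding nonzero_on_def top_run_def by auto
  next
    case False
    then have "top_run n S = {}" by (auto simp: top_run_def)
    then show ?thesis using False by (simp add: nonzero_on_def)
  qed
  finally show ?thesis .
qed

lemma top_run_linked:
  assumes "S \<subseteq> {1..n}" "linked (S - {n}) x y" "x \<in> top_run n S"
  shows "y \<in> top_run n S"
proof (cases "x = y")
  case False
  have "y \<in> {1..n}"
    by (rule linked_distinct_range[of "S - {n}" n y x]) (use assms False linked_sym in auto)
  moreover have "{y..n} \<subseteq> {x..n} \<union> {min x y..<max x y}"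
    by auto
  ultimately show ?thesis
    using assms unfolding top_run_def linked_def by blast
qed (use assms(3) in simp)

text \<open>Block permutations map the top run to itself, so the colour condition can be counted
  apart from the sorting.\<close>

lemma nonzero_on_top_run:
  assumes S: "S \<subseteq> {1..n}" and \<sigma>: "\<sigma> \<in> block_perms n (S - {n})"
  shows "nonzero_on (top_run n S) (w, \<tau> \<circ> inv \<sigma>) \<longleftrightarrow> nonzero_on (top_run n S) (w', \<tau>)"
proof -
  have "\<sigma> x \<in> top_run n S \<longleftrightarrow> x \<in> top_run n S" for x
    using top_run_linked[OF S] block_permsD(2)[OF \<sigma>] linked_sym by blast
  then show ?thesis
    unfolding nonzero_on_def using permutes_inverses[OF block_permsD(1)[OF \<sigma>]]
    by (metis comp_apply snd_conv)
qed

section \<open>Double counting over families of bijections\<close>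

text \<open>Counts the pairs \<open>(s, g)\<close> with \<open>P (act s g)\<close> in two ways: each
  \<open>act s\<close> permutes the finite set \<open>C\<close>, so every \<open>s\<close>
  contributes equally, while the fibre over \<open>g\<close> has \<open>m\<close> elements or
  none.\<close>

lemma double_count:
  assumes "finite C" "finite G"
    and "\<And>s. s \<in> G \<Longrightarrow> inj_on (act s) C" "\<And>s g. s \<in> G \<Longrightarrow> g \<in> C \<Longrightarrow> act s g \<in> C"
    and fibre: "\<And>g. g \<in> C \<Longrightarrow> card {s \<in> G. P (act s g)} = (if Q g then m else 0)"
  shows "card G * card {g \<in> C. P g} = m * card {g \<in> C. Q g}"
proof -
  have "card {g \<in> C. P (act s g)} = card {g \<in> C. P g}" if "s \<in> G" for s
  proof -
    have "act s ` C = C"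
      using assms(1,3,4) that by (intro endo_inj_surj) auto
    then have "bij_betw (act s) C C"
      using assms(3) that by (simp add: bij_betw_def)
    then have "bij_betw (act s) {g \<in> C. P (act s g)} {g \<in> C. P g}"
      by (rule bij_betw_Collect) simp
    then show ?thesis
      by (rule bij_betw_same_card)
  qed
  then have "card G * card {g \<in> C. P g} = (\<Sum>s\<in>G. card {g \<in> C. P (act s g)})"
    by simp
  also have "\<dots> = (\<Sum>g\<in>C. if Q g then m else 0)"
    by (rule sum_multicount_gen) (use assms(1,2) fibre in auto)
  also have "\<dots> = m * card {g \<in> C. Q g}"
    using assms(1) by (simp add: sum.If_cases Int_def)
  finally show ?thesis .
qed

lemma finite_colored_perms: "finite (colored_perms n r)"
  unfolding colored_perms_def
  by (rule finite_cartesian_product) (simp_all add: finite_permutations finite_PiE)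

text \<open>Common frame for conjugation and right multiplication, which differ only in
  \<open>w\<close>. Among the images of \<open>g\<close>, only the one under its unique sorting
  \<open>\<sigma>\<close> can have all descents in \<open>S\<close>, and it does exactly when the
  colours on the top run are nonzero.\<close>

lemma card_descents_sorting:
  assumes A: "A \<subseteq> colored_perms n r" and S: "S \<subseteq> {1..n}"
    and inj: "\<And>\<sigma>. \<sigma> \<in> block_perms n (S - {n}) \<Longrightarrow> inj_on (act \<sigma>) A"
    and closed: "\<And>\<sigma> g. \<sigma> \<in> block_perms n (S - {n}) \<Longrightarrow> g \<in> A \<Longrightarrow> act \<sigma> g \<in> A"
    and act: "\<And>\<sigma> g. act \<sigma> g = (w \<sigma> g \<circ> inv \<sigma>, snd g \<circ> inv \<sigma>)"
    and sort: "\<And>g. g \<in> A \<Longrightarrow>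
      \<exists>!\<sigma>. \<sigma> \<in> block_perms n (S - {n}) \<and> sorts (S - {n}) (w \<sigma> g) (snd g) \<sigma>"
  shows "card (block_perms n (S - {n})) * card {g \<in> A. \<forall>i\<in>S. descent n g i}
    = card {g \<in> A. nonzero_on (top_run n S) g}"
proof -
  let ?B = "block_perms n (S - {n})" and ?U = "nonzero_on (top_run n S)"
  have "card ?B * card {g \<in> A. \<forall>i\<in>S. descent n g i} = 1 * card {g \<in> A. ?U g}"
  proof (rule double_count[where act = act])
    fix g assume g: "g \<in> A"
    obtain \<sigma> where \<sigma>: "{\<sigma>. \<sigma> \<in> ?B \<and> sorts (S - {n}) (w \<sigma> g) (snd g) \<sigma>} = {\<sigma>}"
      using sort[OF g] by auto
    have "(\<forall>i\<in>S. descent n (act \<sigma> g) i) \<longleftrightarrow> sorts (S - {n}) (w \<sigma> g) (snd g) \<sigma> \<and> ?U g"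
      if "\<sigma> \<in> ?B" for \<sigma>
    proof -
      have "act \<sigma> g \<in> colored_perms n r"
        using closed[OF that g] A by blast
      then have "(\<forall>i\<in>S. descent n (act \<sigma> g) i) \<longleftrightarrow> ordered (S - {n}) (act \<sigma> g) \<and> ?U (act \<sigma> g)"
        by (rule descents_iff[OF _ S])
      then show ?thesis
        using ordered_iff_sorts[OF that] nonzero_on_top_run[OF S that, of _ "snd g" "fst g"]
        by (simp add: act)
    qed
    then have "{\<sigma> \<in> ?B. \<forall>i\<in>S. descent n (act \<sigma> g) i} = (if ?U g then {\<sigma>} else {})"
      unfolding \<sigma>[symmetric] by auto
    then show "card {\<sigma> \<in> ?B. \<forall>i\<in>S. descent n (act \<sigma> g) i} = (if ?U g then 1 else 0)"
      by simp
  qed (use inj closed finite_subset[OF A finite_colored_perms] in auto)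
  then show ?thesis by simp
qed

text \<open>As \<open>\<rho>\<close> varies, freeness makes the colours on \<open>L\<close> run
  through all \<open>r ^ card L\<close> possibilities once each, of which
  \<open>(r - 1) ^ card L\<close> avoid zero.\<close>

lemma card_nonzero_on:
  assumes A: "A \<subseteq> colored_perms n r" and L: "L \<subseteq> {1..n}"
    and inj: "\<And>\<rho>. \<rho> \<in> PiE_dflt L 0 (\<lambda>_. {0..<r}) \<Longrightarrow> inj_on (act \<rho>) A"
    and closed: "\<And>\<rho> g. \<rho> \<in> PiE_dflt L 0 (\<lambda>_. {0..<r}) \<Longrightarrow> g \<in> A \<Longrightarrow> act \<rho> g \<in> A"
    and free: "\<And>g \<rho> \<rho>'. g \<in> A \<Longrightarrow> \<rho> \<in> PiE_dflt L 0 (\<lambda>_. {0..<r}) \<Longrightarrow>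
      \<rho>' \<in> PiE_dflt L 0 (\<lambda>_. {0..<r}) \<Longrightarrow>
      (\<And>x. x \<in> L \<Longrightarrow> snd (act \<rho> g) x = snd (act \<rho>' g) x) \<Longrightarrow> \<rho> = \<rho>'"
  shows "r ^ card L * card {g \<in> A. nonzero_on L g} = (r - 1) ^ card L * card A"
proof -
  let ?R = "PiE_dflt L 0 (\<lambda>_. {0..<r})" and ?R1 = "PiE_dflt L 0 (\<lambda>_. {1..<r})"
  have finL: "finite L" using L by (rule finite_subset) simp
  have finR: "finite ?R" using finL by (intro finite_PiE_dflt) auto
  have "card ?R * card {g \<in> A. nonzero_on L g} = (r - 1) ^ card L * card {g \<in> A. True}"
  proof (rule double_count[where act = act])
    fix g assume g: "g \<in> A"
    \<comment> \<open>The default 0 off \<open>L\<close> makes \<open>F\<close> a self-map of the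
      finite set \<open>?R\<close>, so injectivity yields surjectivity.\<close>
    define F where "F \<rho> = (\<lambda>x. if x \<in> L then snd (act \<rho> g) x else 0)" for \<rho>
    have "inj_on F ?R"
    proof (rule inj_onI)
      fix \<rho> \<rho>' assume "\<rho> \<in> ?R" "\<rho>' \<in> ?R" "F \<rho> = F \<rho>'"
      then show "\<rho> = \<rho>'"
        by (intro free[OF g]) (auto simp: F_def fun_eq_iff split: if_splits)
    qed
    moreover have "F \<rho> \<in> ?R" if "\<rho> \<in> ?R" for \<rho>
    proof -
      have "act \<rho> g \<in> colored_perms n r"
        using closed[OF that g] A by blast
      then have "snd (act \<rho> g) x < r" if "x \<in> L" for x
        using colored_permsD(2) L that by blast
      then show ?thesis
        by (auto simp: F_def PiE_dflt_def)
    qed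
    ultimately have onto: "F ` ?R = ?R"
      using finR by (intro endo_inj_surj) auto
    have "F ` {\<rho> \<in> ?R. nonzero_on L (act \<rho> g)} = {t \<in> F ` ?R. \<forall>x\<in>L. t x \<noteq> 0}"
      by (auto simp: F_def nonzero_on_def)
    also have "\<dots> = ?R1"
      unfolding onto by (force simp: PiE_dflt_def)
    finally have "F ` {\<rho> \<in> ?R. nonzero_on L (act \<rho> g)} = ?R1" .
    moreover have "inj_on F {\<rho> \<in> ?R. nonzero_on L (act \<rho> g)}"
      using \<open>inj_on F ?R\<close> by (rule inj_on_subset) auto
    ultimately have "card {\<rho> \<in> ?R. nonzero_on L (act \<rho> g)} = card ?R1"
      using card_image by fastforce
    then show "card {\<rho> \<in> ?R. nonzero_on L (act \<rho> g)} = (if True then (r - 1) ^ card L else 0)"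
      using finL by (simp add: card_PiE_dflt)
  qed (use inj closed finR finite_subset[OF A finite_colored_perms] in auto)
  then show ?thesis
    using finL by (simp add: card_PiE_dflt)
qed

subsection \<open>Actions on coloured permutations\<close>

text \<open>Conjugation by \<open>(\<sigma>, 0)\<close>; the bracketing exhibits
  \<open>\<sigma> \<circ> fst g\<close> as the word that is rearranged.\<close>

definition perm_conj :: "(nat \<Rightarrow> nat) \<Rightarrow> (nat \<Rightarrow> nat) \<times> (nat \<Rightarrow> nat) \<Rightarrow> (nat \<Rightarrow> nat) \<times> (nat \<Rightarrow> nat)" where
  "perm_conj \<sigma> g = ((\<sigma> \<circ> fst g) \<circ> inv \<sigma>, snd g \<circ> inv \<sigma>)"

text \<open>Right multiplication by \<open>(inv \<sigma>, 0)\<close>: letters and colours move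
  together, the letters keeping their values.\<close>

definition perm_shift :: "(nat \<Rightarrow> nat) \<Rightarrow> (nat \<Rightarrow> nat) \<times> (nat \<Rightarrow> nat) \<Rightarrow> (nat \<Rightarrow> nat) \<times> (nat \<Rightarrow> nat)" where
  "perm_shift \<sigma> g = (fst g \<circ> inv \<sigma>, snd g \<circ> inv \<sigma>)"

text \<open>The added colour may depend on the underlying permutation, which stays fixed; the
  restriction keeps colourings extensional.\<close>

definition recolor :: "nat \<Rightarrow> nat \<Rightarrow> ((nat \<Rightarrow> nat) \<Rightarrow> nat \<Rightarrow> nat) \<Rightarrow>
    (nat \<Rightarrow> nat) \<times> (nat \<Rightarrow> nat) \<Rightarrow> (nat \<Rightarrow> nat) \<times> (nat \<Rightarrow> nat)" where
  "recolor n r d g = (fst g, \<lambda>x\<in>{1..n}. (snd g x + d (fst g) x) mod r)"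

text \<open>Conjugation by \<open>(id, \<rho>)\<close>, where \<open>r - \<rho> x\<close> stands for \<open>- \<rho> x\<close> in \<open>\<int>/r\<close>.\<close>

definition color_conj ::
    "nat \<Rightarrow> nat \<Rightarrow> (nat \<Rightarrow> nat) \<Rightarrow> (nat \<Rightarrow> nat) \<times> (nat \<Rightarrow> nat) \<Rightarrow> (nat \<Rightarrow> nat) \<times> (nat \<Rightarrow> nat)" where
  "color_conj n r \<rho> = recolor n r (\<lambda>\<omega> x. \<rho> (\<omega> x) + (r - \<rho> x))"

text \<open>Right multiplication by \<open>(id, \<rho>)\<close>.\<close>

definition color_shift ::
    "nat \<Rightarrow> nat \<Rightarrow> (nat \<Rightarrow> nat) \<Rightarrow> (nat \<Rightarrow> nat) \<times> (nat \<Rightarrow> nat) \<Rightarrow> (nat \<Rightarrow> nat) \<times> (nat \<Rightarrow> nat)" where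
  "color_shift n r \<rho> = recolor n r (\<lambda>_. \<rho>)"

section \<open>Injectivity and closure of the actions\<close>

lemma colored_permsI:
  assumes "fst g permutes {1..n}" "\<And>x. x \<in> {1..n} \<Longrightarrow> snd g x < r" "\<And>x. x \<notin> {1..n} \<Longrightarrow> snd g x = undefined"
  shows "g \<in> colored_perms n r"
  using assms unfolding colored_perms_def mem_Times_iff by (auto intro!: PiE_I)

lemma comp_inv_cancel:
  assumes "\<sigma> permutes A" "f \<circ> inv \<sigma> = f' \<circ> inv \<sigma>"
  shows "f = f'"
proof
  fix x
  have "(f \<circ> inv \<sigma>) (\<sigma> x) = (f' \<circ> inv \<sigma>) (\<sigma> x)"
    by (simp only: assms(2))
  then show "f x = f' x"
    by (simp add: permutes_inverses[OF assms(1)])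
qed

lemma perm_conj_inj:
  assumes \<sigma>: "\<sigma> permutes {1..n}"
  shows "inj_on (perm_conj \<sigma>) A"
proof (rule inj_onI)
  fix g g' assume "perm_conj \<sigma> g = perm_conj \<sigma> g'"
  then have "\<sigma> \<circ> fst g = \<sigma> \<circ> fst g'" and "snd g = snd g'"
    unfolding perm_conj_def by (auto dest: comp_inv_cancel[OF \<sigma>])
  moreover from this(1) have "fst g = fst g'"
    using permutes_inj[OF \<sigma>] by (simp add: fun_eq_iff inj_eq)
  ultimately show "g = g'" by (simp add: prod_eq_iff)
qed

lemma perm_shift_inj:
  assumes \<sigma>: "\<sigma> permutes {1..n}"
  shows "inj_on (perm_shift \<sigma>) A"
  unfolding perm_shift_def inj_on_def prod_eq_iff fst_conv snd_conv
  using comp_inv_cancel[OF \<sigma>] by blast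

lemma colors_comp_inv:
  assumes g: "g \<in> colored_perms n r" and \<sigma>: "\<sigma> permutes {1..n}"
  shows "x \<in> {1..n} \<Longrightarrow> (snd g \<circ> inv \<sigma>) x < r" "x \<notin> {1..n} \<Longrightarrow> (snd g \<circ> inv \<sigma>) x = undefined"
proof -
  have "inv \<sigma> x \<in> {1..n} \<longleftrightarrow> x \<in> {1..n}"
    by (rule permutes_in_image[OF permutes_inv[OF \<sigma>]])
  then show "x \<in> {1..n} \<Longrightarrow> (snd g \<circ> inv \<sigma>) x < r" "x \<notin> {1..n} \<Longrightarrow> (snd g \<circ> inv \<sigma>) x = undefined"
    by (auto intro: colored_permsD(2,3)[OF g])
qed

lemma perm_shift_closed:
  assumes "g \<in> colored_perms n r" "\<sigma> permutes {1..n}"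
  shows "perm_shift \<sigma> g \<in> colored_perms n r"
proof (rule colored_permsI)
  show "fst (perm_shift \<sigma> g) permutes {1..n}"
    unfolding perm_shift_def fst_conv
    by (intro permutes_compose permutes_inv assms(2) colored_permsD(1)[OF assms(1)])
qed (simp_all only: perm_shift_def snd_conv colors_comp_inv[OF assms] not_False_eq_True)

lemma perm_conj_closed:
  assumes g: "g \<in> colored_perms n r" and \<sigma>: "\<sigma> permutes {1..n}"
  shows "perm_conj \<sigma> g \<in> colored_perms n r"
proof (rule colored_permsI)
  show "fst (perm_conj \<sigma> g) permutes {1..n}"
    unfolding perm_conj_def fst_conv
    by (intro permutes_compose permutes_inv \<sigma> colored_permsD(1)[OF g])
qed (simp_all only: perm_conj_def snd_conv colors_comp_inv[OF g \<sigma>] not_False_eq_True)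

section \<open>Invariance of the coloured cycle type\<close>

lemma orbit_conj:
  assumes \<sigma>: "\<sigma> permutes A"
  shows "orbit (\<sigma> \<circ> \<omega> \<circ> inv \<sigma>) (\<sigma> x) = \<sigma> ` orbit \<omega> x"
proof -
  have "((\<sigma> \<circ> \<omega> \<circ> inv \<sigma>) ^^ i) (\<sigma> x) = \<sigma> ((\<omega> ^^ i) x)" for i
    by (induction i) (simp_all add: permutes_inverses[OF \<sigma>])
  then show ?thesis by (auto simp: orbit_altdef)
qed

text \<open>Cycles are carried to their images under \<open>\<sigma>\<close> together with the
  colours of their points, which preserves lengths and colour sums.\<close>

lemma perm_conj_type:
  assumes \<sigma>: "\<sigma> permutes {1..n}"
  shows "colored_cycle_type n r (perm_conj \<sigma> g) = colored_cycle_type n r g"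
proof -
  have supports: "cycle_supports n (fst (perm_conj \<sigma> g)) = image \<sigma> ` cycle_supports n (fst g)"
  proof -
    have "cycle_supports n (fst (perm_conj \<sigma> g)) = orbit (\<sigma> \<circ> fst g \<circ> inv \<sigma>) ` (\<sigma> ` {1..n})"
      unfolding perm_conj_def cycle_supports_def by (simp only: fst_conv permutes_image[OF \<sigma>])
    then show ?thesis
      by (simp only: cycle_supports_def image_image orbit_conj[OF \<sigma>])
  qed
  have inj: "inj_on \<sigma> A" for A
    using permutes_inj[OF \<sigma>] by (rule inj_on_subset) simp
  have color: "cycle_color r (snd (perm_conj \<sigma> g)) (\<sigma> ` A) = cycle_color r (snd g) A" for A
    by (simp add: cycle_color_def perm_conj_def sum.reindex[OF inj] permutes_inverses[OF \<sigma>])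
  have "image_mset card (mset_set {A \<in> cycle_supports n (fst (perm_conj \<sigma> g)).
          cycle_color r (snd (perm_conj \<sigma> g)) A = j})
      = image_mset card (mset_set {A \<in> cycle_supports n (fst g). cycle_color r (snd g) A = j})" for j
  proof -
    have "{A \<in> cycle_supports n (fst (perm_conj \<sigma> g)). cycle_color r (snd (perm_conj \<sigma> g)) A = j}
        = image \<sigma> ` {A \<in> cycle_supports n (fst g). cycle_color r (snd g) A = j}"
      unfolding supports using color by auto
    moreover have "inj_on (image \<sigma>) X" for X
      using permutes_inj[OF \<sigma>] by (simp add: inj_on_def inj_image_eq_iff)
    ultimately show ?thesis
      by (simp add: image_mset_mset_set[symmetric] multiset.map_comp comp_def card_image[OF inj])
  qed
  then show ?thesis by (simp add: colored_cycle_type_def)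
qed

lemma recolor_closed:
  assumes "g \<in> colored_perms n r" "r \<ge> 1"
  shows "recolor n r d g \<in> colored_perms n r"
  by (rule colored_permsI) (use assms(2) colored_permsD(1)[OF assms(1)] in \<open>auto simp: recolor_def\<close>)

lemma orbit_image_eq:
  fixes \<omega> :: "nat \<Rightarrow> nat"
  assumes "\<omega> permutes {1..n}" "x \<in> {1..n}"
  shows "\<omega> ` orbit \<omega> x = orbit \<omega> x" "orbit \<omega> x \<subseteq> {1..n}"
proof -
  show sub: "orbit \<omega> x \<subseteq> {1..n}"
    by (rule permutes_orbit_subset[OF assms])
  show "\<omega> ` orbit \<omega> x = orbit \<omega> x"
  proof (rule endo_inj_surj)
    show "finite (orbit \<omega> x)" using sub by (rule finite_subset) simp
    show "\<omega> ` orbit \<omega> x \<subseteq> orbit \<omega> x" by (auto intro: orbit.step)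
  qed (rule permutes_inj_on[OF assms(1)])
qed

text \<open>The permutation maps the support of a cycle onto itself, so the added terms
  \<open>\<rho> (fst g x)\<close> and \<open>- \<rho> x\<close> cancel modulo \<open>r\<close> in
  the colour sum.\<close>

lemma color_conj_type:
  assumes g: "g \<in> colored_perms n r" and \<rho>: "\<And>x. \<rho> x \<le> r"
  shows "colored_cycle_type n r (color_conj n r \<rho> g) = colored_cycle_type n r g"
proof -
  have "cycle_color r (snd (color_conj n r \<rho> g)) A = cycle_color r (snd g) A"
    if "A \<in> cycle_supports n (fst g)" for A
  proof -
    have A: "fst g ` A = A" "A \<subseteq> {1..n}"
      using that orbit_image_eq[OF colored_permsD(1)[OF g]] unfolding cycle_supports_def by blast+
    have "(\<Sum>x\<in>A. snd (color_conj n r \<rho> g) x)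
        = (\<Sum>x\<in>A. (snd g x + (\<rho> (fst g x) + (r - \<rho> x))) mod r)"
      by (rule sum.cong) (use A(2) in \<open>auto simp: color_conj_def recolor_def\<close>)
    then have "cycle_color r (snd (color_conj n r \<rho> g)) A
        = (\<Sum>x\<in>A. snd g x + (\<rho> (fst g x) + (r - \<rho> x))) mod r"
      by (simp add: cycle_color_def mod_sum_eq)
    also have "(\<Sum>x\<in>A. \<rho> (fst g x)) = (\<Sum>x\<in>fst g ` A. \<rho> x)"
      using permutes_inj_on[OF colored_permsD(1)[OF g]] by (simp add: sum.reindex)
    then have "(\<Sum>x\<in>A. snd g x + (\<rho> (fst g x) + (r - \<rho> x)))
        = (\<Sum>x\<in>A. snd g x) + (\<Sum>x\<in>A. \<rho> x + (r - \<rho> x))"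
      by (simp add: sum.distrib A(1))
    \<comment> \<open>The bound \<open>\<rho> x \<le> r\<close> makes the truncated differences
      exact, leaving one \<open>r\<close> per point of the cycle.\<close>
    also have "\<dots> = (\<Sum>x\<in>A. snd g x) + card A * r"
      using \<rho> by simp
    finally show ?thesis by (simp add: cycle_color_def)
  qed
  moreover have "fst (color_conj n r \<rho> g) = fst g"
    by (simp add: color_conj_def recolor_def)
  ultimately have "{A \<in> cycle_supports n (fst (color_conj n r \<rho> g)). cycle_color r (snd (color_conj n r \<rho> g)) A = j}
      = {A \<in> cycle_supports n (fst g). cycle_color r (snd g) A = j}" for j
    by auto
  then show ?thesis by (simp add: colored_cycle_type_def)
qed

section \<open>Cancellation and freeness of recolourings\<close>

lemma add_mod_cancel_nat:
  fixes a b c r :: nat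
  assumes "(a + c) mod r = (b + c) mod r" "a < r" "b < r"
  shows "a = b"
proof -
  \<comment> \<open>\<open>r * c - c\<close> serves as the additive inverse of \<open>c\<close>
    modulo \<open>r\<close>; \<open>r\<close> is positive because \<open>a < r\<close>.\<close>
  have "c + (r * c - c) = r * c"
    using assms(2) by (cases r) simp_all
  then have *: "u mod r = (u + c + (r * c - c)) mod r" for u
    by (simp only: add.assoc mod_mult_self2)
  have "a mod r = (a + c + (r * c - c)) mod r"
    by (rule *)
  also have "\<dots> = (b + c + (r * c - c)) mod r"
    by (rule mod_add_cong[OF assms(1) refl])
  also have "\<dots> = b mod r"
    by (rule *[symmetric])
  finally show ?thesis using assms by simp
qed

lemma recolor_inj: "inj_on (recolor n r d) (colored_perms n r)"
proof (rule inj_onI)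
  fix g g' assume g: "g \<in> colored_perms n r" "g' \<in> colored_perms n r"
    and eq: "recolor n r d g = recolor n r d g'"
  have \<omega>: "fst g = fst g'" using eq by (simp add: recolor_def)
  have "snd g x = snd g' x" for x
  proof (cases "x \<in> {1..n}")
    case True
    then have "snd (recolor n r d g) x = snd (recolor n r d g') x"
      by (simp only: eq)
    then have "(snd g x + d (fst g) x) mod r = (snd g' x + d (fst g) x) mod r"
      using True \<omega> by (simp add: recolor_def)
    then show ?thesis
      by (rule add_mod_cancel_nat) (rule colored_permsD(2), rule g, rule True)+
  next
    case False
    then show ?thesis using colored_permsD(3) g by metis
  qed
  then show "g = g'" using \<omega> by (auto simp: prod_eq_iff)
qed

text \<open>The new colour at \<open>x\<close> fixes \<open>\<rho> (fst g x) - \<rho> x\<close>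
  modulo \<open>r\<close>, so agreement of \<open>\<rho>\<close> and \<open>\<rho>'\<close> at
  \<open>fst g x\<close> passes back to \<open>x\<close>. Off \<open>L\<close> both are 0, and
  iterating \<open>fst g\<close> leads out of \<open>L\<close> from every point.\<close>

lemma color_conj_free:
  assumes L: "L \<subseteq> {1..n}" and escape: "\<And>x. \<exists>i. (fst g ^^ i) x \<notin> L"
    and \<rho>: "\<rho> \<in> PiE_dflt L 0 (\<lambda>_. {0..<r})" and \<rho>': "\<rho>' \<in> PiE_dflt L 0 (\<lambda>_. {0..<r})"
    and eq: "\<And>x. x \<in> L \<Longrightarrow> snd (color_conj n r \<rho> g) x = snd (color_conj n r \<rho>' g) x"
  shows "\<rho> = \<rho>'"
proof
  fix x
  have "\<rho> x = \<rho>' x" if "(fst g ^^ i) x \<notin> L" for i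
    using that
  proof (induction i arbitrary: x)
    case 0
    then show ?case using \<rho> \<rho>' by (auto simp: PiE_dflt_def)
  next
    case (Suc i)
    then have IH: "\<rho> (fst g x) = \<rho>' (fst g x)" by (simp add: funpow_swap1)
    show ?case
    proof (cases "x \<in> L")
      case True
      let ?c = "snd g x + \<rho> (fst g x)"
      have lt: "\<rho> x < r" "\<rho>' x < r" using True \<rho> \<rho>' by (auto simp: PiE_dflt_def)
      have "(?c + (r - \<rho> x)) mod r = (?c + (r - \<rho>' x)) mod r"
        using eq[OF True] IH True L by (auto simp: color_conj_def recolor_def add.assoc subset_iff)
      \<comment> \<open>Adding \<open>\<rho> x + \<rho>' x\<close> to both sides clears the
        truncated subtractions.\<close>
      then have "(?c + (r - \<rho> x) + (\<rho> x + \<rho>' x)) mod r = (?c + (r - \<rho>' x) + (\<rho> x + \<rho>' x)) mod r"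
        by (rule mod_add_cong) simp
      moreover have "?c + (r - \<rho> x) + (\<rho> x + \<rho>' x) = (\<rho>' x + ?c) + r"
        "?c + (r - \<rho>' x) + (\<rho> x + \<rho>' x) = (\<rho> x + ?c) + r"
        using lt by simp_all
      ultimately have "(\<rho>' x + ?c) mod r = (\<rho> x + ?c) mod r"
        by (simp only: mod_add_self2)
      then show ?thesis
        using add_mod_cancel_nat lt by metis
    next
      case False
      then show ?thesis using \<rho> \<rho>' by (auto simp: PiE_dflt_def)
    qed
  qed
  then show "\<rho> x = \<rho>' x" using escape by blast
qed

lemma color_shift_free:
  assumes L: "L \<subseteq> {1..n}"
    and \<rho>: "\<rho> \<in> PiE_dflt L 0 (\<lambda>_. {0..<r})" and \<rho>': "\<rho>' \<in> PiE_dflt L 0 (\<lambda>_. {0..<r})"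
    and eq: "\<And>x. x \<in> L \<Longrightarrow> snd (color_shift n r \<rho> g) x = snd (color_shift n r \<rho>' g) x"
  shows "\<rho> = \<rho>'"
proof
  fix x show "\<rho> x = \<rho>' x"
  proof (cases "x \<in> L")
    case True
    then have "(\<rho> x + snd g x) mod r = (\<rho>' x + snd g x) mod r"
      using eq L by (auto simp: color_shift_def recolor_def add.commute subset_iff)
    then show ?thesis
      by (rule add_mod_cancel_nat) (use True \<rho> \<rho>' in \<open>auto simp: PiE_dflt_def\<close>)
  next
    case False
    then show ?thesis using \<rho> \<rho>' by (auto simp: PiE_dflt_def)
  qed
qed

subsection \<open>Densities and moments\<close>

lemma colored_perms_nonempty: "r \<ge> 1 \<Longrightarrow> colored_perms n r \<noteq> {}"
proof -
  assume "r \<ge> 1"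
  then have "(id, \<lambda>x\<in>{1..n}. 0) \<in> colored_perms n r"
    by (intro colored_permsI) (auto simp: permutes_id)
  then show ?thesis by blast
qed

text \<open>A forward orbit confined to \<open>K\<close> would be a cycle with between 1 and
  \<open>m\<close> points, whose length is a part of the entry of \<open>\<Lambda>\<close> for its
  colour.\<close>

lemma colored_class_escape:
  assumes g: "g \<in> colored_class n r \<Lambda>" and "r \<ge> 1"
    and long: "\<forall>\<mu>\<in>set \<Lambda>. \<forall>l\<in>#\<mu>. l \<notin> {1..m}"
    and K: "K \<subseteq> {1..n}" "card K \<le> m"
  shows "\<exists>i. (fst g ^^ i) x \<notin> K"
proof (rule ccontr)
  assume "\<nexists>i. (fst g ^^ i) x \<notin> K"
  then have in_K: "(fst g ^^ i) x \<in> K" for i by blast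
  let ?A = "orbit (fst g) x" and ?j = "cycle_color r (snd g) (orbit (fst g) x)"
  have "x \<in> {1..n}" using in_K[of 0] K(1) by auto
  then have A: "?A \<in> cycle_supports n (fst g)" by (simp add: cycle_supports_def)
  have "finite K" using K(1) by (rule finite_subset) simp
  have "?A \<subseteq> K" using in_K by (auto simp: orbit_altdef)
  then have le: "finite ?A" "card ?A \<le> m"
    using \<open>finite K\<close> K(2) card_mono finite_subset by (blast, meson le_trans)
  moreover have "?A \<noteq> {}" by (rule orbit_nonempty)
  ultimately have card_A: "card ?A \<in> {1..m}" by (simp add: Suc_le_eq card_gt_0_iff)
  have j: "?j < r" using \<open>r \<ge> 1\<close> by (simp add: cycle_color_def)
  let ?X = "{A \<in> cycle_supports n (fst g). cycle_color r (snd g) A = ?j}"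
  have "finite ?X" by (simp add: cycle_supports_def)
  then have "card ?A \<in># image_mset card (mset_set ?X)" using A by auto
  moreover have "image_mset card (mset_set ?X) \<in> set \<Lambda>"
    using g j by (auto simp: colored_class_def colored_cycle_type_def)
  ultimately show False using long card_A by blast
qed

lemma top_run_subset: "top_run n S \<subseteq> {1..n}" "card (top_run n S) \<le> card S" if "S \<subseteq> {1..n}"
proof -
  show "top_run n S \<subseteq> {1..n}" by (auto simp: top_run_def)
  have "top_run n S \<subseteq> S" by (auto simp: top_run_def subset_iff)
  then show "card (top_run n S) \<le> card S"
    using that finite_subset by (intro card_mono) auto
qed

text \<open>The probability that all of \<open>S\<close> are descents: one block permutation in all
  sorts, and each position of the top run contributes a factor \<open>(r - 1) / r\<close>. No cycle
  type enters.\<close>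

definition descents_density :: "nat \<Rightarrow> nat \<Rightarrow> nat set \<Rightarrow> real" where
  "descents_density n r S =
     (real (r - 1) / real r) ^ card (top_run n S) / real (card (block_perms n (S - {n})))"

lemma descents_densityI:
  assumes "r \<ge> 1" "finite A" "A \<noteq> {}"
    and "card (block_perms n (S - {n})) * X = Y"
    and "r ^ card (top_run n S) * Y = (r - 1) ^ card (top_run n S) * card A"
  shows "real X / real (card A) = descents_density n r S"
proof -
  define b l where "b = card (block_perms n (S - {n}))" and "l = card (top_run n S)"
  have pos: "real b \<noteq> 0" "real (card A) \<noteq> 0" "real r ^ l \<noteq> 0"
    using assms(1-3) block_perms_id by (auto simp: b_def)
  have "r ^ l * (b * X) = (r - 1) ^ l * card A"
    using assms(4,5) by (simp add: b_def l_def)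
  then have "real r ^ l * (real b * real X) = real (r - 1) ^ l * real (card A)"
    by (metis of_nat_mult of_nat_power)
  then show ?thesis
    unfolding descents_density_def b_def[symmetric] l_def[symmetric] power_divide
      divide_divide_eq_left frac_eq_eq[OF pos(2) no_zero_divisors[OF pos(3,1)]]
    by (simp only: ac_simps)
qed

text \<open>Under right multiplication the letters do not depend on \<open>\<sigma>\<close>, so
  \<open>ex1_block_sort\<close> applies, and \<open>color_shift\<close> varies the colours on the
  top run independently.\<close>

lemma descents_density_perms:
  assumes r: "r \<ge> 1" and S: "S \<subseteq> {1..n}"
  shows "card {g \<in> colored_perms n r. \<forall>i\<in>S. descent n g i} / card (colored_perms n r)
    = descents_density n r S"
proof -
  let ?A = "colored_perms n r" and ?B = "block_perms n (S - {n})" and ?L = "top_run n S"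
  have "card ?B * card {g \<in> ?A. \<forall>i\<in>S. descent n g i} = card {g \<in> ?A. nonzero_on ?L g}"
  proof (rule card_descents_sorting[where act = perm_shift and w = "\<lambda>_. fst", OF order_refl S])
    fix g assume "g \<in> ?A"
    then have "inj (fst g)" using colored_permsD(1) permutes_inj by blast
    then show "\<exists>!\<sigma>. \<sigma> \<in> ?B \<and> sorts (S - {n}) (fst g) (snd g) \<sigma>"
      using S by (intro ex1_block_sort) auto
  next
    fix \<sigma> assume "\<sigma> \<in> ?B"
    then show "inj_on (perm_shift \<sigma>) ?A"
      by (intro perm_shift_inj block_permsD(1))
  next
    fix \<sigma> g assume "\<sigma> \<in> ?B" "g \<in> ?A"
    then show "perm_shift \<sigma> g \<in> ?A"
      by (intro perm_shift_closed block_permsD(1))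
  qed (rule perm_shift_def)
  moreover have "r ^ card ?L * card {g \<in> ?A. nonzero_on ?L g} = (r - 1) ^ card ?L * card ?A"
    by (rule card_nonzero_on[where act = "color_shift n r", OF order_refl top_run_subset(1)[OF S]])
      (auto simp: color_shift_def intro: recolor_inj recolor_closed[OF _ r]
        color_shift_free[OF top_run_subset(1)[OF S], unfolded color_shift_def])
  ultimately show ?thesis
    by (rule descents_densityI[OF r finite_colored_perms colored_perms_nonempty[OF r]])
qed

text \<open>Conjugation stays inside the class. The bound \<open>2 * k\<close> enters because at
  most \<open>k\<close> descents involve at most \<open>2 * k\<close> positions, which therefore
  contain no whole cycle.\<close>

lemma descents_density_class:
  assumes r: "r \<ge> 1" and S: "S \<subseteq> {1..n}" "card S \<le> k" and ne: "colored_class n r \<Lambda> \<noteq> {}"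
    and long: "\<forall>\<mu>\<in>set \<Lambda>. \<forall>l\<in>#\<mu>. l \<notin> {1..2 * k}"
  shows "card {g \<in> colored_class n r \<Lambda>. \<forall>i\<in>S. descent n g i} / card (colored_class n r \<Lambda>)
    = descents_density n r S"
proof -
  let ?C = "colored_class n r \<Lambda>" and ?B = "block_perms n (S - {n})"
    and ?L = "top_run n S" and ?T = "S - {n}"
  have sub: "?C \<subseteq> colored_perms n r" by (auto simp: colored_class_def)
  have fin: "finite S" using S(1) by (rule finite_subset) simp
  have T: "?T \<subseteq> {1..<n}" using S(1) by auto
  have escape_T: "\<exists>i. (fst g ^^ i) x \<notin> ?T \<union> Suc ` ?T" if "g \<in> ?C" for g x
  proof (rule colored_class_escape[OF that r long])
    show "?T \<union> Suc ` ?T \<subseteq> {1..n}" using T by auto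
    have "card (?T \<union> Suc ` ?T) \<le> card ?T + card (Suc ` ?T)" by (rule card_Un_le)
    also have "\<dots> \<le> 2 * card S"
      using card_image_le[of ?T Suc] card_mono[of S ?T] fin by simp
    finally show "card (?T \<union> Suc ` ?T) \<le> 2 * k" using S(2) by linarith
  qed
  \<comment> \<open>The top run has at most \<open>k\<close> positions, so the absence of short
    cycles applies to it as well.\<close>
  have escape_L: "\<exists>i. (fst g ^^ i) x \<notin> ?L" if "g \<in> ?C" for g x
    by (rule colored_class_escape[OF that r long])
      (use top_run_subset[OF S(1)] S(2) in linarith)+
  have "card ?B * card {g \<in> ?C. \<forall>i\<in>S. descent n g i} = card {g \<in> ?C. nonzero_on ?L g}"
  proof (rule card_descents_sorting[where act = perm_conj and w = "\<lambda>\<sigma> g. \<sigma> \<circ> fst g", OF sub S(1)])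
    fix g assume g: "g \<in> ?C"
    show "\<exists>!\<sigma>. \<sigma> \<in> ?B \<and> sorts ?T (\<sigma> \<circ> fst g) (snd g) \<sigma>"
      by (rule ex1_conj_sort[OF T colored_permsD(1) escape_T[OF g]]) (use g sub in blast)
  next
    fix \<sigma> assume "\<sigma> \<in> ?B"
    then show "inj_on (perm_conj \<sigma>) ?C"
      by (intro perm_conj_inj block_permsD(1))
  next
    fix \<sigma> g assume "\<sigma> \<in> ?B" "g \<in> ?C"
    then show "perm_conj \<sigma> g \<in> ?C"
      using block_permsD(1) by (simp add: colored_class_def perm_conj_closed perm_conj_type)
  qed (rule perm_conj_def)
  moreover have "r ^ card ?L * card {g \<in> ?C. nonzero_on ?L g} = (r - 1) ^ card ?L * card ?C"
  proof (rule card_nonzero_on[where act = "color_conj n r", OF sub top_run_subset(1)[OF S(1)]])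
    fix \<rho> show "inj_on (color_conj n r \<rho>) ?C"
      unfolding color_conj_def by (rule inj_on_subset[OF recolor_inj sub])
  next
    fix \<rho> g assume \<rho>: "\<rho> \<in> PiE_dflt ?L 0 (\<lambda>_. {0..<r})" and "g \<in> ?C"
    then have g: "g \<in> colored_perms n r" "colored_cycle_type n r g = \<Lambda>"
      by (simp_all add: colored_class_def)
    have "\<rho> x \<le> r" for x
      using \<rho> by (cases "x \<in> ?L") (auto simp: PiE_dflt_def intro: less_imp_le)
    then have "colored_cycle_type n r (color_conj n r \<rho> g) = \<Lambda>"
      using color_conj_type[OF g(1)] g(2) by simp
    moreover have "color_conj n r \<rho> g \<in> colored_perms n r"
      unfolding color_conj_def by (rule recolor_closed[OF g(1) r])
    ultimately show "color_conj n r \<rho> g \<in> ?C"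
      by (simp add: colored_class_def)
  qed (rule color_conj_free[OF top_run_subset(1)[OF S(1)] escape_L])
  ultimately show ?thesis
    by (rule descents_densityI[OF r finite_subset[OF sub finite_colored_perms] ne])
qed

section \<open>Moments from joint descent probabilities\<close>

text \<open>Expanding the power yields one term per tuple \<open>f\<close> of indices; a product of
  indicators depends only on the image of \<open>f\<close>, where repeated indices merge.\<close>

lemma uniform_expectation_power:
  fixes c :: "nat \<Rightarrow> real"
  assumes A: "finite A" "A \<noteq> {}" and I: "finite I"
  shows "uniform_expectation A (\<lambda>g. (\<Sum>i\<in>I. c i * of_bool (P g i)) ^ k)
    = (\<Sum>f\<in>{..<k} \<rightarrow>\<^sub>E I. (\<Prod>j<k. c (f j)) * (card {g \<in> A. \<forall>i\<in>f ` {..<k}. P g i} / card A))"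
proof -
  have "(\<Sum>i\<in>I. c i * of_bool (P g i)) ^ k
      = (\<Sum>f\<in>{..<k} \<rightarrow>\<^sub>E I. (\<Prod>j<k. c (f j)) * of_bool (\<forall>i\<in>f ` {..<k}. P g i))" for g
  proof -
    have "(\<Sum>i\<in>I. c i * of_bool (P g i)) ^ k = (\<Prod>j<k. \<Sum>i\<in>I. c i * of_bool (P g i))"
      by simp
    also have "\<dots> = (\<Sum>f\<in>{..<k} \<rightarrow>\<^sub>E I. \<Prod>j<k. c (f j) * of_bool (P g (f j)))"
      by (rule prod_sum_PiE) (use I in auto)
    also have "\<dots> = (\<Sum>f\<in>{..<k} \<rightarrow>\<^sub>E I. (\<Prod>j<k. c (f j)) * of_bool (\<forall>i\<in>f ` {..<k}. P g i))"
    proof (rule sum.cong[OF refl])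
      fix f
      have "(\<Prod>j<k. of_bool (P g (f j)) :: real) = of_bool (\<forall>i\<in>f ` {..<k}. P g i)"
        by (induction k) (auto simp: less_Suc_eq)
      then show "(\<Prod>j<k. c (f j) * of_bool (P g (f j))) = (\<Prod>j<k. c (f j)) * of_bool (\<forall>i\<in>f ` {..<k}. P g i)"
        by (simp add: prod.distrib)
    qed
    finally show ?thesis .
  qed
  then have "uniform_expectation A (\<lambda>g. (\<Sum>i\<in>I. c i * of_bool (P g i)) ^ k)
      = (\<Sum>g\<in>A. \<Sum>f\<in>{..<k} \<rightarrow>\<^sub>E I. (\<Prod>j<k. c (f j)) * of_bool (\<forall>i\<in>f ` {..<k}. P g i)) / card A"
    unfolding uniform_expectation_def by (simp only: integral_pmf_of_set[OF A(2,1)])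
  also have "\<dots> = (\<Sum>f\<in>{..<k} \<rightarrow>\<^sub>E I. (\<Prod>j<k. c (f j)) * (\<Sum>g\<in>A. of_bool (\<forall>i\<in>f ` {..<k}. P g i))) / card A"
    by (subst sum.swap) (simp only: sum_distrib_left)
  also have "\<dots> = (\<Sum>f\<in>{..<k} \<rightarrow>\<^sub>E I. (\<Prod>j<k. c (f j)) * (card {g \<in> A. \<forall>i\<in>f ` {..<k}. P g i} / card A))"
    using A(1) by (simp add: sum_divide_distrib sum_of_bool_eq Int_def)
  finally show ?thesis .
qed

text \<open>A tuple of length \<open>k\<close> has at most \<open>k\<close> distinct entries, so
  joint probabilities of at most \<open>k\<close> events determine the moment, even across different
  sample spaces.\<close>

lemma uniform_expectation_power_cong:
  fixes c :: "nat \<Rightarrow> real"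
  assumes "finite A" "A \<noteq> {}" "finite B" "B \<noteq> {}" "finite I"
    and density: "\<And>S. S \<subseteq> I \<Longrightarrow> card S \<le> k \<Longrightarrow>
      card {g \<in> A. \<forall>i\<in>S. P g i} / card A = card {h \<in> B. \<forall>i\<in>S. Q h i} / card B"
  shows "uniform_expectation A (\<lambda>g. (\<Sum>i\<in>I. c i * of_bool (P g i)) ^ k)
    = uniform_expectation B (\<lambda>h. (\<Sum>i\<in>I. c i * of_bool (Q h i)) ^ k)"
  unfolding uniform_expectation_power[OF assms(1,2,5)] uniform_expectation_power[OF assms(3,4,5)]
proof (rule sum.cong[OF refl])
  fix f assume f: "f \<in> {..<k} \<rightarrow>\<^sub>E I"
  have "f ` {..<k} \<subseteq> I" using f by auto
  moreover have "card (f ` {..<k}) \<le> k" using card_image_le[of "{..<k}" f] by simp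
  ultimately show "(\<Prod>j<k. c (f j)) * (card {g \<in> A. \<forall>i\<in>f ` {..<k}. P g i} / card A)
      = (\<Prod>j<k. c (f j)) * (card {h \<in> B. \<forall>i\<in>f ` {..<k}. Q h i} / card B)"
    by (simp only: density)
qed

lemma weighted_descents_drop_last:
  assumes "c n = 0"
  shows "weighted_descents n c g = (\<Sum>i\<in>{1..<n}. c i * of_bool (descent n g i))"
  unfolding weighted_descents_def
  by (rule sum.mono_neutral_right) (use assms in \<open>auto simp: not_less\<close>)

text \<open>With one colour only the zero colouring remains and symbols compare by value;
  \<open>c n = 0\<close> discards the boundary descent, which the classical statistic lacks.\<close>

lemma uniform_expectation_classical:
  assumes "c n = 0"
  shows "uniform_expectation {\<omega>. \<omega> permutes {1..n}} (\<lambda>\<omega>. classical_weighted_descents n c \<omega> ^ k)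
    = uniform_expectation (colored_perms n 1) (\<lambda>g. weighted_descents n c g ^ k)"
proof -
  define t :: "nat \<Rightarrow> nat" where "t = (\<lambda>x\<in>{1..n}. 0)"
  let ?P = "{\<omega>. \<omega> permutes {1..n}}"
  have "({1..n} \<rightarrow>\<^sub>E {0..<1::nat}) = ({1..n} \<rightarrow>\<^sub>E {0})" by (rule PiE_cong) auto
  also have "\<dots> = (\<Pi>\<^sub>E x\<in>{1..n}. {t x})" by (rule PiE_cong) (simp add: t_def)
  also have "\<dots> = {t}" unfolding t_def by (rule PiE_singleton[OF restrict_extensional])
  finally have eq: "colored_perms n 1 = (\<lambda>\<omega>. (\<omega>, t)) ` ?P"
    by (auto simp: colored_perms_def)
  have inj: "inj_on (\<lambda>\<omega>. (\<omega>, t)) ?P" by (simp add: inj_on_def)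
  have fin: "finite ?P" by (simp add: finite_permutations)
  have ne: "?P \<noteq> {}" using permutes_id by blast
  have same: "weighted_descents n c (\<omega>, t) = classical_weighted_descents n c \<omega>" for \<omega>
    unfolding weighted_descents_drop_last[where c = c and n = n, OF assms] classical_weighted_descents_def
    by (rule sum.cong) (auto simp: descent_def symbol_at_def symbol_less_def t_def)
  have "uniform_expectation (colored_perms n 1) (\<lambda>g. weighted_descents n c g ^ k)
      = (\<Sum>g\<in>colored_perms n 1. weighted_descents n c g ^ k) / card (colored_perms n 1)"
    unfolding uniform_expectation_def
    by (rule integral_pmf_of_set) (simp_all add: colored_perms_nonempty finite_colored_perms)
  also have "\<dots> = (\<Sum>\<omega>\<in>?P. classical_weighted_descents n c \<omega> ^ k) / card ?P"
    unfolding eq card_image[OF inj] sum.reindex[OF inj] by (simp add: same)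
  also have "\<dots> = uniform_expectation ?P (\<lambda>\<omega>. classical_weighted_descents n c \<omega> ^ k)"
    unfolding uniform_expectation_def by (rule integral_pmf_of_set[OF ne fin, symmetric])
  finally show ?thesis by (rule sym)
qed

theorem theorem3p13:
  fixes n r k :: nat and c :: "nat \<Rightarrow> real" and \<Lambda> :: "nat multiset list"
  assumes "r \<ge> 1" and "k \<ge> 1"
    and "colored_class n r \<Lambda> \<noteq> {}"
    and "\<forall>\<mu>\<in>set \<Lambda>. \<forall>l\<in>#\<mu>. l \<notin> {1..2 * k}"
  shows "uniform_expectation (colored_class n r \<Lambda>) (\<lambda>g. weighted_descents n c g ^ k)
           = uniform_expectation (colored_perms n r) (\<lambda>g. weighted_descents n c g ^ k)
       \<and> (c n = 0 \<longrightarrow>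
           uniform_expectation (colored_class n r \<Lambda>) (\<lambda>g. weighted_descents n c g ^ k)
           = uniform_expectation {\<omega>. \<omega> permutes {1..n}}
               (\<lambda>\<omega>. classical_weighted_descents n c \<omega> ^ k))"
proof -
  have perms: "finite (colored_perms n q)" "q \<ge> 1 \<Longrightarrow> colored_perms n q \<noteq> {}" for q
    by (rule finite_colored_perms, rule colored_perms_nonempty)
  have "finite (colored_class n r \<Lambda>)"
    by (rule finite_subset[OF _ perms(1)]) (auto simp: colored_class_def)
  then have main: "uniform_expectation (colored_class n r \<Lambda>) (\<lambda>g. weighted_descents n c g ^ k)
      = uniform_expectation (colored_perms n r) (\<lambda>g. weighted_descents n c g ^ k)"
    unfolding weighted_descents_def
  proof (rule uniform_expectation_power_cong)
    fix S assume "S \<subseteq> {1..n}" "card S \<le> k"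
    then show "card {g \<in> colored_class n r \<Lambda>. \<forall>i\<in>S. descent n g i} / card (colored_class n r \<Lambda>)
        = card {g \<in> colored_perms n r. \<forall>i\<in>S. descent n g i} / card (colored_perms n r)"
      using descents_density_class[OF assms(1) _ _ assms(3,4)] descents_density_perms[OF assms(1)]
      by simp
  qed (use perms assms(1,3) in simp_all)
  \<comment> \<open>With \<open>c n = 0\<close> only index sets inside \<open>{1..<n}\<close> arise.
    Their top run is empty, so the density does not depend on the number of colours and
    \<open>r\<close> can be replaced by 1.\<close>
  have "uniform_expectation (colored_perms n r) (\<lambda>g. weighted_descents n c g ^ k)
      = uniform_expectation (colored_perms n 1) (\<lambda>g. weighted_descents n c g ^ k)" if "c n = 0"
    unfolding weighted_descents_drop_last[where c = c and n = n, OF that]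
  proof (rule uniform_expectation_power_cong)
    fix S assume S: "S \<subseteq> {1..<n}"
    then have "top_run n S = {}" by (force simp: top_run_def subset_iff)
    then have "descents_density n r S = descents_density n 1 S"
      by (simp add: descents_density_def)
    moreover have "S \<subseteq> {1..n}" using S by auto
    ultimately show "card {g \<in> colored_perms n r. \<forall>i\<in>S. descent n g i} / card (colored_perms n r)
        = card {g \<in> colored_perms n 1. \<forall>i\<in>S. descent n g i} / card (colored_perms n 1)"
      by (simp only: descents_density_perms[OF assms(1)] descents_density_perms[OF order_refl])
  qed (use perms assms(1) in simp_all)
  then show ?thesis
    using main uniform_expectation_classical by simp
qed

end
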